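(* Let $G$ be a finite group of order $\ell:=|G|>1$ and let $X$ be a nonempty metric free $G$-space. Let $\mathfrak{q}^X\colon X\to X/G$ be the quotient map, and let $n=\mathrm{ind}_2(X,G)$. Then $$n+2\leq \mathrm{IC}(\mathfrak{q}^X)\leq \mathrm{IC}\left(\mathfrak{q}^{F(\mathbb{R}^{n+1},\ell)}\right),$$ where $\mathfrak{q}^{F(\mathbb{R}^{n+1},\ell)}\colon F(\mathbb{R}^{n+1},\ell)\to F(\mathbb{R}^{n+1},\ell)/G$ is the quotient map. Both inequalities are equalities whenever $G=\mathbb{Z}_2$. (If $n=\infty$, then $n+2$ is read as $\infty$ and $\mathbb{R}^{n+1}$ as $\mathbb{R}^\infty$.)
   Context: "Map" means continuous map. For a map $f\colon X\to Y$, the injective category number $\mathrm{IC}(f)$ is the smallest positive integer $k$ such that there are open subsets $U_1,\ldots,U_k\subset X$ with $X=U_1\cup\cdots\cup U_k$ and each restriction $f_{|U_j}\colon U_j\to Y$ injective; $\mathrm{IC}(f)=\infty$ if no such $k$ exists. A metric free $G$-space is a metric space (as a topological space) with a free left action of $G$ by homeomorphisms; $X/G$ is the orbit space with the quotient topology. For a free $G$-space $Z$, $\mathfrak{q}^Z\colon Z\to Z/G$ is the quotient map. The ordered configuration space is $F(Y,\ell)=\{(y_1,\ldots,y_\ell)\in Y^\ell:\ y_i\neq y_j \text{ for } i\neq j\}$ with the subspace topology from $Y^\ell$. Write $G=\{g_1,\ldots,g_\ell\}$ and let $h\colon G\to\{1,\ldots,\ell\}$ be the bijection $h(g_j)=j$.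 Then $G$ acts on the left of $Y^\ell$ by $g(y_1,\ldots,y_\ell)=(y_{h(g^{-1}g_1)},\ldots,y_{h(g^{-1}g_\ell)})$, which restricts to a free left action on $F(Y,\ell)$; $F(Y,\ell)$ is always regarded as a $G$-space with this action. The $2$-th index $\mathrm{ind}_2(X,G)$ of a free $G$-space $X$ is the least integer $n\in\{0,1,2,\ldots\}$ such that there exists a (continuous) $G$-equivariant map $X\to F(\mathbb{R}^{n+1},\ell)$; $\mathrm{ind}_2(X,G)=\infty$ if no such $n$ exists. $\mathbb{R}^\infty=\bigcup_{k}\mathbb{R}^k$ with the colimit topology. *)

theory Defs
  imports
    "HOL-Analysis.Analysis"
    "HOL-Library.Extended_Nat"
    "HOL-Algebra.Group_Action"
    "HOL-Algebra.Elementary_Groups"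
begin

section \<open>Injective category number\<close>

text \<open>
  Only the topology of the domain enters, so the topology of the codomain of the map \<open>f\<close>
  is not a parameter. The infimum of the empty set in \<^typ>\<open>enat\<close> is \<open>\<infinity>\<close>.
\<close>

definition IC :: "'a topology \<Rightarrow> ('a \<Rightarrow> 'b) \<Rightarrow> enat" where
  "IC X f = Inf {enat k | k. 1 \<le> k \<and>
     (\<exists>U. (\<forall>i\<in>{1..k}. openin X (U i) \<and> inj_on f (U i)) \<and> topspace X = (\<Union>i\<in>{1..k}. U i))}"

section \<open>Free G-spaces and orbit spaces\<close>

text \<open>
  In a library \<^const>\<open>group_action\<close> every \<open>\<phi> g\<close> is extensional: it is \<^const>\<open>undefined\<close>
  outside the space acted upon.
\<close>

definition free_G_space ::
  "('g, 'm) monoid_scheme \<Rightarrow> 'a topology \<Rightarrow> ('g \<Rightarrow> 'a \<Rightarrow> 'a) \<Rightarrow> bool" where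
  "free_G_space G X \<phi> \<longleftrightarrow>
     group_action G (topspace X) \<phi> \<and>
     (\<forall>g\<in>carrier G. homeomorphic_map X X (\<phi> g)) \<and>
     (\<forall>g\<in>carrier G. \<forall>x\<in>topspace X. \<phi> g x = x \<longrightarrow> g = \<one>\<^bsub>G\<^esub>)"

definition equivariant_map ::
  "('g, 'm) monoid_scheme \<Rightarrow> 'a topology \<Rightarrow> ('g \<Rightarrow> 'a \<Rightarrow> 'a) \<Rightarrow>
   'b topology \<Rightarrow> ('g \<Rightarrow> 'b \<Rightarrow> 'b) \<Rightarrow> ('a \<Rightarrow> 'b) \<Rightarrow> bool" where
  "equivariant_map G X \<phi> Y \<psi> f \<longleftrightarrow>
     continuous_map X Y f \<and>
     (\<forall>g\<in>carrier G. \<forall>x\<in>topspace X. f (\<phi> g x) = \<psi> g (f x))"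

definition orbit_space ::
  "('g, 'm) monoid_scheme \<Rightarrow> 'a topology \<Rightarrow> ('g \<Rightarrow> 'a \<Rightarrow> 'a) \<Rightarrow> 'a set topology" where
  "orbit_space G X \<phi> =
     topology (\<lambda>U. U \<subseteq> orbits G (topspace X) \<phi> \<and> openin X {x \<in> topspace X. orbit G \<phi> x \<in> U})"

lemma openin_orbit_space:
  "openin (orbit_space G X \<phi>) U \<longleftrightarrow>
     U \<subseteq> orbits G (topspace X) \<phi> \<and> openin X {x \<in> topspace X. orbit G \<phi> x \<in> U}"
proof -
  have "istopology (\<lambda>U. U \<subseteq> orbits G (topspace X) \<phi> \<and>
          openin X {x \<in> topspace X. orbit G \<phi> x \<in> U})"
    unfolding istopology_def
  proof (intro conjI allI impI)
    fix S T
    assume S: "S \<subseteq> orbits G (topspace X) \<phi> \<and> openin X {x \<in> topspace X. orbit G \<phi> x \<in> S}"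
      and T: "T \<subseteq> orbits G (topspace X) \<phi> \<and> openin X {x \<in> topspace X. orbit G \<phi> x \<in> T}"
    have "{x \<in> topspace X. orbit G \<phi> x \<in> S \<inter> T} =
          {x \<in> topspace X. orbit G \<phi> x \<in> S} \<inter> {x \<in> topspace X. orbit G \<phi> x \<in> T}"
      by blast
    then show "openin X {x \<in> topspace X. orbit G \<phi> x \<in> S \<inter> T}"
      using S T by auto
    show "S \<inter> T \<subseteq> orbits G (topspace X) \<phi>"
      using S by blast
  next
    fix \<K>
    assume K: "\<forall>S\<in>\<K>. S \<subseteq> orbits G (topspace X) \<phi> \<and>
      openin X {x \<in> topspace X. orbit G \<phi> x \<in> S}"
    have "{x \<in> topspace X. orbit G \<phi> x \<in> \<Union>\<K>} =
          (\<Union>S\<in>\<K>. {x \<in> topspace X. orbit G \<phi> x \<in> S})"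
      by blast
    then show "openin X {x \<in> topspace X. orbit G \<phi> x \<in> \<Union>\<K>}"
      using K by auto
    show "\<Union>\<K> \<subseteq> orbits G (topspace X) \<phi>"
      using K by blast
  qed
  then show ?thesis
    by (simp add: orbit_space_def topology_inverse')
qed

text \<open>
  The quotient map of a \<open>G\<close>-space is \<^term>\<open>orbit G \<phi>\<close>.
\<close>

lemma topspace_orbit_space: "topspace (orbit_space G X \<phi>) = orbits G (topspace X) \<phi>"
proof -
  have "{x \<in> topspace X. orbit G \<phi> x \<in> orbits G (topspace X) \<phi>} = topspace X"
    by (auto simp: orbits_def)
  then have "openin (orbit_space G X \<phi>) (orbits G (topspace X) \<phi>)"
    by (simp add: openin_orbit_space)
  then show ?thesis
    by (meson openin_orbit_space openin_subset openin_topspace subset_antisym)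
qed

lemma quotient_map_orbit: "quotient_map X (orbit_space G X \<phi>) (orbit G \<phi>)"
  unfolding quotient_map_def topspace_orbit_space openin_orbit_space
  by (auto simp: orbits_def)

section \<open>Ordered configuration spaces\<close>

text \<open>Tuples are functions that are extensional on the index set \<open>{1..l}\<close>.\<close>

definition conf_space :: "'a topology \<Rightarrow> nat \<Rightarrow> (nat \<Rightarrow> 'a) topology" where
  "conf_space Y l = subtopology (product_topology (\<lambda>_. Y) {1..l})
     {y. \<forall>i\<in>{1..l}. \<forall>j\<in>{1..l}. i \<noteq> j \<longrightarrow> y i \<noteq> y j}"

text \<open>
  For a bijection \<open>h\<close> from \<^term>\<open>carrier G\<close> onto \<open>{1..order G}\<close>, the element \<open>g\<^sub>j\<close> of the
  enumeration is \<^term>\<open>inv_into (carrier G) h j\<close>.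
\<close>

definition conf_action ::
  "('g, 'm) monoid_scheme \<Rightarrow> ('g \<Rightarrow> nat) \<Rightarrow> 'a topology \<Rightarrow> 'g \<Rightarrow> (nat \<Rightarrow> 'a) \<Rightarrow> (nat \<Rightarrow> 'a)" where
  "conf_action G h Y g =
     (\<lambda>y\<in>topspace (conf_space Y (order G)). \<lambda>j\<in>{1..order G}.
        y (h (inv\<^bsub>G\<^esub> g \<otimes>\<^bsub>G\<^esub> inv_into (carrier G) h j)))"

lemma topspace_conf_space:
  "topspace (conf_space Y l) =
     {y \<in> {1..l} \<rightarrow>\<^sub>E topspace Y. inj_on y {1..l}}"
  by (auto simp: conf_space_def inj_on_def)

lemma free_G_space_conf_space:
  fixes G (structure)
  assumes "group G" and "bij_betw h (carrier G) {1..order G}"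
  shows "free_G_space G (conf_space Y (order G)) (conf_action G h Y)"
proof -
  interpret group G by fact
  define e where "e = inv_into (carrier G) h"
  define I where "I = {1..order G}"
  let ?F = "conf_space Y (order G)"
  let ?a = "conf_action G h Y"
  have h_in: "h g \<in> I" if "g \<in> carrier G" for g
    using assms(2) that unfolding I_def by (meson bij_betwE)
  have e_in: "e j \<in> carrier G" if "j \<in> I" for j
    using assms(2) that unfolding e_def I_def by (metis bij_betw_imp_surj_on inv_into_into)
  have he: "h (e j) = j" if "j \<in> I" for j
    using assms(2) that unfolding e_def I_def by (meson bij_betw_inv_into_right)
  have eh: "e (h g) = g" if "g \<in> carrier G" for g
    using assms(2) that unfolding e_def I_def by (meson bij_betw_inv_into_left)
  have top: "topspace ?F = {y \<in> I \<rightarrow>\<^sub>E topspace Y. inj_on y I}"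
    by (simp add: topspace_conf_space I_def)
  have F: "?F = subtopology (product_topology (\<lambda>_. Y) I) {y. \<forall>i\<in>I. \<forall>j\<in>I. i \<noteq> j \<longrightarrow> y i \<noteq> y j}"
    by (simp add: conf_space_def I_def)
  have app: "?a g y j = y (h (inv g \<otimes> e j))" if "y \<in> topspace ?F" "j \<in> I" for g y j
    using that by (simp add: conf_action_def e_def I_def)
  have h_inj: "g = g'" if "h g = h g'" "g \<in> carrier G" "g' \<in> carrier G" for g g'
    using that eh by metis
  have cl: "?a g y \<in> topspace ?F" if g: "g \<in> carrier G" and y: "y \<in> topspace ?F" for g y
  proof -
    have yF: "y \<in> I \<rightarrow>\<^sub>E topspace Y" "inj_on y I"
      using y by (auto simp: top)
    have "inj_on (?a g y) I"
    proof (rule inj_onI)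
      fix i j assume ij: "i \<in> I" "j \<in> I" and eq: "?a g y i = ?a g y j"
      have "h (inv g \<otimes> e i) = h (inv g \<otimes> e j)"
        using eq[unfolded app[OF y ij(1)] app[OF y ij(2)]]
        by (rule inj_onD[OF yF(2)]) (intro h_in m_closed inv_closed g e_in ij)+
      then have "inv g \<otimes> e i = inv g \<otimes> e j"
        using g ij by (intro h_inj) (auto intro: e_in)
      then have "e i = e j"
        using g ij e_in by (metis inv_closed Units_eq Units_l_cancel)
      then show "i = j"
        using he ij by metis
    qed
    moreover have "?a g y \<in> I \<rightarrow>\<^sub>E topspace Y"
    proof (rule PiE_I)
      fix j assume j: "j \<in> I"
      show "?a g y j \<in> topspace Y"
        unfolding app[OF y j] by (intro PiE_mem[OF yF(1)] h_in m_closed inv_closed g e_in j)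
    next
      fix j assume "j \<notin> I"
      then show "?a g y j = undefined"
        unfolding conf_action_def I_def[symmetric] using y by simp
    qed
    ultimately show ?thesis by (simp add: top)
  qed
  have ext: "y = z" if "y \<in> topspace ?F" "z \<in> topspace ?F" "\<And>j. j \<in> I \<Longrightarrow> y j = z j" for y z
    using that unfolding top by (auto intro: PiE_ext)
  have mult: "?a (g \<otimes> k) y = ?a g (?a k y)"
    if "g \<in> carrier G" "k \<in> carrier G" "y \<in> topspace ?F" for g k y
  proof (rule ext)
    fix j assume j: "j \<in> I"
    have "?a g (?a k y) j = y (h (inv k \<otimes> e (h (inv g \<otimes> e j))))"
      using that j e_in[OF j] by (simp add: app cl h_in)
    also have "\<dots> = y (h (inv (g \<otimes> k) \<otimes> e j))"
      using that e_in[OF j] by (simp add: eh inv_mult_group m_assoc)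
    finally show "?a (g \<otimes> k) y j = ?a g (?a k y) j"
      using that j by (simp add: app)
  qed (use that cl in auto)
  have one: "?a \<one> y = y" if "y \<in> topspace ?F" for y
    by (rule ext) (use that cl e_in he in \<open>auto simp: app\<close>)
  have extl: "?a g \<in> extensional (topspace ?F)" for g
    by (simp add: conf_action_def)
  have "bij_betw (?a g) (topspace ?F) (topspace ?F)" if g: "g \<in> carrier G" for g
    by (rule bij_betw_byWitness[where f' = "?a (inv g)"])
      (use g in \<open>auto simp: cl mult[symmetric] one\<close>)
  then have Bij: "?a g \<in> Bij (topspace ?F)" if "g \<in> carrier G" for g
    using that extl by (simp add: Bij_def)
  have act: "group_action G (topspace ?F) ?a"
    unfolding group_action_def
  proof (intro group_hom.intro group_hom_axioms.intro group_BijGroup homI)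
    fix g k assume gk: "g \<in> carrier G" "k \<in> carrier G"
    have "?a (g \<otimes> k) = compose (topspace ?F) (?a g) (?a k)"
      by (rule extensionalityI[OF extl compose_extensional])
        (use gk in \<open>simp add: mult compose_eq\<close>)
    then show "?a (g \<otimes> k) = ?a g \<otimes>\<^bsub>BijGroup (topspace ?F)\<^esub> ?a k"
      using gk Bij by (simp add: BijGroup_def)
  qed (use Bij in \<open>auto simp: BijGroup_def is_group\<close>)
  have cont: "continuous_map ?F ?F (?a g)" if g: "g \<in> carrier G" for g
  proof -
    have "continuous_map ?F (product_topology (\<lambda>_. Y) I) (?a g)"
      unfolding continuous_map_componentwise
    proof (intro conjI ballI)
      show "?a g ` topspace ?F \<subseteq> extensional I"
        using cl[OF g] by (auto simp: top PiE_def)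
      fix j assume j: "j \<in> I"
      have "h (inv g \<otimes> e j) \<in> I"
        using g e_in[OF j] by (intro h_in) auto
      then have "continuous_map ?F Y (\<lambda>y. y (h (inv g \<otimes> e j)))"
        unfolding F
        by (intro continuous_map_from_subtopology continuous_map_product_projection)
      then show "continuous_map ?F Y (\<lambda>y. ?a g y j)"
        by (rule continuous_map_eq) (simp add: app j)
    qed
    then show ?thesis
      using cl[OF g] unfolding F continuous_map_in_subtopology by auto
  qed
  have "homeomorphic_map ?F ?F (?a g)" if g: "g \<in> carrier G" for g
    unfolding homeomorphic_map_maps homeomorphic_maps_def
    by (rule exI[where x = "?a (inv g)"])
      (use g in \<open>auto simp: cont mult[symmetric] one\<close>)
  moreover have "g = \<one>"
    if g: "g \<in> carrier G" and y: "y \<in> topspace ?F" and eq: "?a g y = y" for g y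
  proof -
    define j where "j = h \<one>"
    have j: "j \<in> I" unfolding j_def by (intro h_in) simp
    have "e j = \<one>" unfolding j_def by (simp add: eh)
    then have "y (h (inv g)) = y j"
      using app[OF y j, of g] eq g by simp
    then have "h (inv g) = h \<one>"
      using y j g h_in[of "inv g"] unfolding top j_def
      by (auto dest: inj_onD)
    then have "inv g = \<one>" using g by (intro h_inj) auto
    then show ?thesis using g by (metis inv_inv inv_one)
  qed
  ultimately show ?thesis
    using act by (auto simp: free_G_space_def)
qed

section \<open>Euclidean spaces and the second index\<close>

text \<open>
  The library realises \<open>\<real>\<^sup>k\<close> as the sequences vanishing from position \<open>k\<close> on, so that
  \<open>\<real>\<^sup>\<infinity>\<close> is the union of the \<^term>\<open>Euclidean_space k\<close>.
\<close>

definition Euclidean_colimit :: "(nat \<Rightarrow> real) topology" where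
  "Euclidean_colimit =
     topology (\<lambda>U. U \<subseteq> (\<Union>k. topspace (Euclidean_space k)) \<and>
       (\<forall>k. openin (Euclidean_space k) (U \<inter> topspace (Euclidean_space k))))"

lemma openin_Euclidean_colimit:
  "openin Euclidean_colimit U \<longleftrightarrow>
     U \<subseteq> (\<Union>k. topspace (Euclidean_space k)) \<and>
     (\<forall>k. openin (Euclidean_space k) (U \<inter> topspace (Euclidean_space k)))"
proof -
  have "istopology (\<lambda>U. U \<subseteq> (\<Union>k. topspace (Euclidean_space k)) \<and>
       (\<forall>k. openin (Euclidean_space k) (U \<inter> topspace (Euclidean_space k))))"
    unfolding istopology_def
  proof (intro conjI allI impI)
    fix S T :: "(nat \<Rightarrow> real) set" and k
    assume S: "S \<subseteq> (\<Union>k. topspace (Euclidean_space k)) \<and>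
        (\<forall>k. openin (Euclidean_space k) (S \<inter> topspace (Euclidean_space k)))"
      and T: "T \<subseteq> (\<Union>k. topspace (Euclidean_space k)) \<and>
        (\<forall>k. openin (Euclidean_space k) (T \<inter> topspace (Euclidean_space k)))"
    have "S \<inter> T \<inter> topspace (Euclidean_space k) =
      (S \<inter> topspace (Euclidean_space k)) \<inter> (T \<inter> topspace (Euclidean_space k))"
      by blast
    then show "openin (Euclidean_space k) (S \<inter> T \<inter> topspace (Euclidean_space k))"
      using S T by (metis openin_Int)
    show "S \<inter> T \<subseteq> (\<Union>k. topspace (Euclidean_space k))"
      using S by blast
  next
    fix \<K> :: "(nat \<Rightarrow> real) set set" and k
    assume K: "\<forall>S\<in>\<K>. S \<subseteq> (\<Union>k. topspace (Euclidean_space k)) \<and>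
        (\<forall>k. openin (Euclidean_space k) (S \<inter> topspace (Euclidean_space k)))"
    have "\<Union>\<K> \<inter> topspace (Euclidean_space k) = (\<Union>S\<in>\<K>. S \<inter> topspace (Euclidean_space k))"
      by blast
    moreover have "openin (Euclidean_space k) (\<Union>S\<in>\<K>. S \<inter> topspace (Euclidean_space k))"
      by (rule openin_Union) (use K in blast)
    ultimately show "openin (Euclidean_space k) (\<Union>\<K> \<inter> topspace (Euclidean_space k))"
      by simp
    show "\<Union>\<K> \<subseteq> (\<Union>k. topspace (Euclidean_space k))"
      using K by blast
  qed
  then show ?thesis
    by (simp add: Euclidean_colimit_def topology_inverse')
qed

definition Euclidean_enat :: "enat \<Rightarrow> (nat \<Rightarrow> real) topology" where
  "Euclidean_enat m = (case m of enat k \<Rightarrow> Euclidean_space k | \<infinity> \<Rightarrow> Euclidean_colimit)"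

definition ind2 ::
  "('g, 'm) monoid_scheme \<Rightarrow> ('g \<Rightarrow> nat) \<Rightarrow> 'a topology \<Rightarrow> ('g \<Rightarrow> 'a \<Rightarrow> 'a) \<Rightarrow> enat" where
  "ind2 G h X \<phi> = Inf {enat n | n.
     \<exists>f. equivariant_map G X \<phi> (conf_space (Euclidean_space (n + 1)) (order G))
          (conf_action G h (Euclidean_space (n + 1))) f}"

end

theory Submission
  imports Defs
begin

text \<open>
  An equivariant map from \<open>X\<close> to the configuration space of \<open>Y\<close> is the same as a map
  \<open>f : X \<rightarrow> Y\<close> that is injective on every orbit: its coordinates are \<open>f (g\<^sub>j\<^sup>-\<^sup>1 x)\<close>.
  A cover of \<open>X\<close> by \<open>k\<close> open sets, each disjoint from its translates, yields such an \<open>f\<close> into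
  \<open>k\<close>-space, namely a partition of unity whose supports lie in these sets; as the coordinates sum
  to one, one of them may be dropped. This is the lower bound. The upper bound pulls covers back
  along an equivariant map. When the index is infinite, the target is the colimit, and \<open>f\<close>
  consists of a countable locally finite family of functions, which exists because \<open>X\<close>, even if
  it is not separable, has a countable cover by open sets disjoint from their translates. For a
  group of order two, the difference of the two points of a configuration in \<open>m\<close>-space is a
  nonzero vector whose sign is flipped by the action, and \<open>m + 1\<close> open half spaces suffice to
  cover the nonzero vectors.
\<close>

section \<open>Functions on metrizable spaces\<close>

text \<open>Exchanging \<open>x\<close> and \<open>y\<close> turns the one-sided bound into the
  1-Lipschitz condition.\<close>

lemma (in Metric_space) continuous_map_real_Lipschitz:
  fixes f :: "'a \<Rightarrow> real"
  assumes "\<And>x y. x \<in> M \<Longrightarrow> y \<in> M \<Longrightarrow> f x \<le> f y + d x y"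
  shows "continuous_map mtopology euclideanreal f"
  unfolding continuous_map_from_metric
proof (intro conjI ballI allI impI)
  fix a U assume a: "a \<in> M" and U: "openin euclideanreal U \<and> f a \<in> U"
  then obtain e where e: "e > 0" "\<And>z. dist z (f a) < e \<Longrightarrow> z \<in> U"
    by (metis open_dist open_openin)
  have "dist (f x) (f a) \<le> d a x" if "x \<in> M" for x
    using assms[OF a that] assms[OF that a] commute[of a x] by (auto simp: dist_real_def)
  then show "\<exists>r>0. \<forall>x. x \<in> M \<and> d a x < r \<longrightarrow> f x \<in> U"
    using e by (meson order_le_less_trans)
qed simp

text \<open>Off the trivial case \<open>U = topspace X\<close>, \<open>u\<close> is the distance to
  the complement, capped at 1; openness of \<open>U\<close> makes it positive on
  \<open>U\<close>.\<close>

lemma metrizable_space_cozero: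
  assumes "metrizable_space X" "openin X U"
  obtains u :: "'a \<Rightarrow> real" where "continuous_map X euclideanreal u"
    "\<And>x. 0 \<le> u x" "\<And>x. u x \<le> 1" "\<And>x. x \<in> topspace X \<Longrightarrow> 0 < u x \<longleftrightarrow> x \<in> U"
proof (cases "topspace X - U = {}")
  case True
  show ?thesis
    by (rule that[of "\<lambda>_. 1"]) (use True in auto)
next
  case False
  obtain M d where "Metric_space M d" and X: "X = Metric_space.mtopology M d"
    using assms(1) by (auto simp: metrizable_space_def)
  interpret Metric_space M d by fact
  have C: "M - U \<noteq> {}" "U \<subseteq> M"
    using False openin_subset[OF assms(2)] by (auto simp: X)
  define e where "e = (\<lambda>x. INF y\<in>M - U. d x y)"
  have bdd: "bdd_below (d x ` S)" for x S
    by (meson bdd_below.I2 nonneg)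
  have e0: "0 \<le> e x" for x
    unfolding e_def by (intro cINF_greatest C) simp
  have eL: "e x \<le> e y + d x y" if "x \<in> M" "y \<in> M" for x y
  proof -
    have "e x - d x y \<le> e y"
      unfolding e_def
    proof (intro cINF_greatest C)
      fix z assume z: "z \<in> M - U"
      then have "(INF y\<in>M - U. d x y) \<le> d x z"
        by (intro cINF_lower bdd)
      then show "(INF y\<in>M - U. d x y) - d x y \<le> d y z"
        using triangle[of x y z] that z by simp
    qed
    then show ?thesis by simp
  qed
  have "0 < e x \<longleftrightarrow> x \<in> U" if x: "x \<in> M" for x
  proof
    assume "0 < e x"
    show "x \<in> U"
    proof (rule ccontr)
      assume "x \<notin> U"
      then have "e x \<le> d x x"
        unfolding e_def using x by (intro cINF_lower bdd) simp
      then show False using \<open>0 < e x\<close> x by simp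
    qed
  next
    assume "x \<in> U"
    then obtain r where r: "r > 0" "mball x r \<subseteq> U"
      using assms(2) by (auto simp: X openin_mtopology)
    have "r \<le> e x"
      unfolding e_def using C r x by (intro cINF_greatest) (force simp: in_mball)+
    then show "0 < e x" using r by simp
  qed
  moreover have "continuous_map X euclideanreal (\<lambda>x. min 1 (e x))"
    unfolding X by (intro continuous_intros continuous_map_real_Lipschitz eL)
  ultimately show ?thesis
    using e0 by (intro that[of "\<lambda>x. min 1 (e x)"]) (auto simp: X)
qed

text \<open>
  Damping \<open>u\<^sub>n\<close> by \<open>n\<close> times the sum of its predecessors makes a countable cozero cover locally
  finite: near a point where \<open>u\<^sub>N > c > 0\<close> the \<open>n\<close>-th function vanishes once \<open>n c \<ge> 1\<close>.
\<close>

lemma metrizable_space_locally_finite_cozero: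
  fixes W :: "nat \<Rightarrow> 'a set"
  assumes X: "metrizable_space X" and W: "\<And>n. openin X (W n)" and cov: "topspace X \<subseteq> (\<Union>n. W n)"
  obtains v :: "nat \<Rightarrow> 'a \<Rightarrow> real" where "\<And>n. continuous_map X euclideanreal (v n)"
    "\<And>n x. x \<in> topspace X \<Longrightarrow> v n x \<noteq> 0 \<Longrightarrow> x \<in> W n"
    "\<And>x. x \<in> topspace X \<Longrightarrow> \<exists>n. v n x \<noteq> 0"
    "\<And>x. x \<in> topspace X \<Longrightarrow> \<exists>N m. openin X N \<and> x \<in> N \<and> (\<forall>y\<in>N. \<forall>n\<ge>m. v n y = 0)"
proof -
  have "\<forall>n. \<exists>u :: 'a \<Rightarrow> real. continuous_map X euclideanreal u \<and> (\<forall>x. 0 \<le> u x \<and> u x \<le> 1) \<and>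
      (\<forall>x\<in>topspace X. 0 < u x \<longleftrightarrow> x \<in> W n)"
    by (metis metrizable_space_cozero[OF X W])
  then obtain u :: "nat \<Rightarrow> 'a \<Rightarrow> real" where u: "\<And>n. continuous_map X euclideanreal (u n)"
      "\<And>n x. 0 \<le> u n x" "\<And>n x. u n x \<le> 1" "\<And>n x. x \<in> topspace X \<Longrightarrow> 0 < u n x \<longleftrightarrow> x \<in> W n"
    by metis
  define v where "v n x = max 0 (u n x - real n * (\<Sum>i<n. u i x))" for n x
  show thesis
  proof (rule that)
    show "continuous_map X euclideanreal (v n)" for n
      unfolding v_def by (intro continuous_intros u) auto
  next
    fix n x assume x: "x \<in> topspace X" and "v n x \<noteq> 0"
    moreover have "0 \<le> real n * (\<Sum>i<n. u i x)"
      by (intro mult_nonneg_nonneg sum_nonneg u) simp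
    ultimately have "0 < u n x" by (auto simp: v_def max_def split: if_splits)
    then show "x \<in> W n" using u(4) x by blast
  next
    fix x assume x: "x \<in> topspace X"
    have ex: "\<exists>n. 0 < u n x" using x cov u(4) by blast
    \<comment> \<open>At the first \<open>n\<close> with \<open>0 < u n x\<close> all predecessors
      vanish, so \<open>u n x\<close> is not damped at all.\<close>
    define n where "n = (LEAST n. 0 < u n x)"
    have "0 < u n x" unfolding n_def using ex by (rule LeastI_ex)
    moreover have "u i x = 0" if "i < n" for i
      using not_less_Least[of i "\<lambda>n. 0 < u n x"] that u(2)[of i x] by (auto simp: n_def)
    ultimately have "v n x \<noteq> 0" by (simp add: v_def)
    then show "\<exists>n. v n x \<noteq> 0" ..
  next
    fix x assume x: "x \<in> topspace X"
    obtain N where N: "0 < u N x" using x cov u(4) by blast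
    define c where "c = u N x / 2"
    have c: "0 < c" "c < u N x" using N by (auto simp: c_def)
    obtain m where m: "1 / c < real m" using reals_Archimedean2 by blast
    \<comment> \<open>\<open>Suc N\<close> puts \<open>u N\<close> among the damping predecessors;
      \<open>m\<close> makes the damping term at least 1.\<close>
    have "v n y = 0" if y: "c < u N y" and n: "max (Suc N) m \<le> n" for n y
    proof -
      have "u N y \<le> (\<Sum>i<n. u i y)"
        using n u(2) by (intro member_le_sum) auto
      then have "1 \<le> real n * (\<Sum>i<n. u i y)"
        using m n c y by (smt (verit) divide_less_eq max.bounded_iff mult_mono of_nat_0_le_iff of_nat_mono)
      then show ?thesis using u(3)[of n y] by (simp add: v_def)
    qed
    moreover have "openin X {y \<in> topspace X. u N y \<in> {c<..}}"
      by (rule openin_continuous_map_preimage[OF u(1)]) auto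
    ultimately show "\<exists>N m. openin X N \<and> x \<in> N \<and> (\<forall>y\<in>N. \<forall>n\<ge>m. v n y = 0)"
      using x c by (intro exI[of _ "{y \<in> topspace X. u N y \<in> {c<..}}"] exI[of _ "max (Suc N) m"]) auto
  qed
qed

text \<open>Continuity of the coordinates alone is too weak for the colimit topology. Locally,
  however, \<open>f\<close> has values in a single \<open>Euclidean_space m\<close>, a subspace of
  the product, where it suffices.\<close>

lemma continuous_map_Euclidean_colimit:
  assumes cont: "\<And>n. continuous_map X euclideanreal (\<lambda>x. f x n)"
    and fin: "\<And>x. x \<in> topspace X \<Longrightarrow>
      \<exists>N m. openin X N \<and> x \<in> N \<and> f ` N \<subseteq> topspace (Euclidean_space m)"
  shows "continuous_map X Euclidean_colimit f"
proof -
  have top: "topspace Euclidean_colimit = (\<Union>k. topspace (Euclidean_space k))"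
  proof
    show "topspace Euclidean_colimit \<subseteq> (\<Union>k. topspace (Euclidean_space k))"
      using openin_Euclidean_colimit openin_topspace by blast
    have "openin Euclidean_colimit (\<Union>k. topspace (Euclidean_space k))"
      unfolding openin_Euclidean_colimit
    proof (intro conjI allI order_refl)
      fix k
      have "(\<Union>k. topspace (Euclidean_space k)) \<inter> topspace (Euclidean_space k) =
          topspace (Euclidean_space k)"
        by blast
      then show "openin (Euclidean_space k)
          ((\<Union>k. topspace (Euclidean_space k)) \<inter> topspace (Euclidean_space k))"
        by (simp only: openin_topspace)
    qed
    then show "(\<Union>k. topspace (Euclidean_space k)) \<subseteq> topspace Euclidean_colimit"
      by (rule openin_subset)
  qed
  have "openin X {x \<in> topspace X. f x \<in> U}" if U: "openin Euclidean_colimit U" for U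
  proof (subst openin_subopen, intro ballI)
    fix x assume "x \<in> {x \<in> topspace X. f x \<in> U}"
    then have x: "x \<in> topspace X" "f x \<in> U" by auto
    obtain N m where N: "openin X N" "x \<in> N" "f ` N \<subseteq> topspace (Euclidean_space m)"
      using fin[OF x(1)] by blast
    have "continuous_map (subtopology X N) (Euclidean_space m) f"
      unfolding Euclidean_space_def continuous_map_in_subtopology continuous_map_componentwise_UNIV
      using N(3) by (auto intro: continuous_map_from_subtopology cont simp: topspace_Euclidean_space)
    then have "openin (subtopology X N)
        {x \<in> topspace (subtopology X N). f x \<in> U \<inter> topspace (Euclidean_space m)}"
      using U by (intro openin_continuous_map_preimage) (auto simp: openin_Euclidean_colimit)
    moreover have "{x \<in> topspace (subtopology X N). f x \<in> U \<inter> topspace (Euclidean_space m)} =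
        {x \<in> N. f x \<in> U}"
      using N openin_subset by fastforce
    ultimately have "openin X {x \<in> N. f x \<in> U}"
      using N(1) openin_trans_full by fastforce
    then show "\<exists>T. openin X T \<and> x \<in> T \<and> T \<subseteq> {x \<in> topspace X. f x \<in> U}"
      using x N openin_subset by (intro exI[of _ "{x \<in> N. f x \<in> U}"]) fastforce
  qed
  moreover have "f \<in> topspace X \<rightarrow> topspace Euclidean_colimit"
    using fin by (fastforce simp: top)
  ultimately show ?thesis by (simp add: continuous_map_def)
qed

section \<open>Injective category number\<close>

lemma IC_le:
  assumes "1 \<le> k" "\<And>i. i \<in> {1..k} \<Longrightarrow> openin X (U i)" "\<And>i. i \<in> {1..k} \<Longrightarrow> inj_on f (U i)"
    "topspace X = (\<Union>i\<in>{1..k}. U i)"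
  shows "IC X f \<le> enat k"
  unfolding IC_def using assms by (intro Inf_lower) blast

text \<open>A nonempty set in \<open>enat\<close> attains its infimum, and the empty set has infimum
  \<open>\<infinity>\<close>, so a finite value is realised by a cover.\<close>

lemma IC_enatE:
  assumes "IC X f = enat k"
  obtains U where "1 \<le> k" "\<And>i. i \<in> {1..k} \<Longrightarrow> openin X (U i)"
    "\<And>i. i \<in> {1..k} \<Longrightarrow> inj_on f (U i)" "topspace X = (\<Union>i\<in>{1..k}. U i)"
proof -
  define A where "A = {enat k | k. 1 \<le> k \<and>
     (\<exists>U. (\<forall>i\<in>{1..k}. openin X (U i) \<and> inj_on f (U i)) \<and> topspace X = (\<Union>i\<in>{1..k}. U i))}"
  have *: "Inf A = enat k"
    using assms by (simp add: IC_def A_def)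
  then have "A \<noteq> {}" by (auto simp: top_enat_def)
  then have "Inf A \<in> A" by (meson all_not_in_conv wellorder_InfI)
  then obtain U where "1 \<le> k" "\<forall>i\<in>{1..k}. openin X (U i) \<and> inj_on f (U i)"
      "topspace X = (\<Union>i\<in>{1..k}. U i)"
    unfolding * unfolding A_def by auto
  then show thesis by (intro that[of U]) blast+
qed

text \<open>\<open>F\<close> maps each fibre of \<open>p\<close> injectively into a fibre of
  \<open>q\<close>; hence the preimages of a cover for \<open>q\<close> form a cover for
  \<open>p\<close>.\<close>

lemma IC_le_IC:
  assumes F: "continuous_map X Y F"
    and fib: "\<And>x x'. x \<in> topspace X \<Longrightarrow> x' \<in> topspace X \<Longrightarrow> p x = p x' \<Longrightarrow> q (F x) = q (F x')"
    and inj: "\<And>x x'. x \<in> topspace X \<Longrightarrow> x' \<in> topspace X \<Longrightarrow> p x = p x' \<Longrightarrow> F x = F x' \<Longrightarrow> x = x'"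
  shows "IC X p \<le> IC Y q"
proof (cases "IC Y q")
  case (enat k)
  then obtain U where U: "1 \<le> k" "\<And>i. i \<in> {1..k} \<Longrightarrow> openin Y (U i)"
      "\<And>i. i \<in> {1..k} \<Longrightarrow> inj_on q (U i)" "topspace Y = (\<Union>i\<in>{1..k}. U i)"
    by (rule IC_enatE) blast
  have "IC X p \<le> enat k"
  proof (rule IC_le[OF U(1), where U = "\<lambda>i. {x \<in> topspace X. F x \<in> U i}"])
    show "inj_on p {x \<in> topspace X. F x \<in> U i}" if "i \<in> {1..k}" for i
      using U(3)[OF that] fib inj by (auto simp: inj_on_def)
    show "topspace X = (\<Union>i\<in>{1..k}. {x \<in> topspace X. F x \<in> U i})"
      using continuous_map_image_subset_topspace[OF F] U(4) by blast
  qed (use U F in \<open>auto intro: openin_continuous_map_preimage\<close>)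
  then show ?thesis using enat by simp
qed simp

section \<open>Free actions\<close>

locale free_action = group_action G "topspace X" \<phi>
  for G :: "('g, 'm) monoid_scheme" (structure) and X :: "'a topology"
    and \<phi> :: "'g \<Rightarrow> 'a \<Rightarrow> 'a" +
  assumes homeo: "g \<in> carrier G \<Longrightarrow> homeomorphic_map X X (\<phi> g)"
    and free: "g \<in> carrier G \<Longrightarrow> x \<in> topspace X \<Longrightarrow> \<phi> g x = x \<Longrightarrow> g = \<one>"

lemma free_action_iff: "free_action G X \<phi> \<longleftrightarrow> free_G_space G X \<phi>"
  unfolding free_action_def free_action_axioms_def free_G_space_def by blast

sublocale free_action \<subseteq> group G
  using group_hom group_hom.axioms(1) by blast

context free_action
begin

lemma act_closed: "g \<in> carrier G \<Longrightarrow> x \<in> topspace X \<Longrightarrow> \<phi> g x \<in> topspace X"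
  using element_image by blast

lemma act_one: "x \<in> topspace X \<Longrightarrow> \<phi> \<one> x = x"
  by (metis id_eq_one restrict_apply')

lemma act_inv: "g \<in> carrier G \<Longrightarrow> x \<in> topspace X \<Longrightarrow> \<phi> (inv g) (\<phi> g x) = x"
  using orbit_sym_aux by blast

lemma act_inv': "g \<in> carrier G \<Longrightarrow> x \<in> topspace X \<Longrightarrow> \<phi> g (\<phi> (inv g) x) = x"
  by (metis act_inv inv_closed inv_inv)

lemma act_cont: "g \<in> carrier G \<Longrightarrow> continuous_map X X (\<phi> g)"
  using homeo homeomorphic_imp_continuous_map by blast

lemma orbit_eqD:
  assumes "x \<in> topspace X" "y \<in> topspace X" "orbit G \<phi> x = orbit G \<phi> y"
  obtains g where "g \<in> carrier G" "y = \<phi> g x"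
proof -
  have "y \<in> orbit G \<phi> x" using assms orbit_refl by auto
  then show ?thesis using that by (auto simp: orbit_def)
qed

lemma orbit_act:
  assumes "x \<in> topspace X" "g \<in> carrier G"
  shows "orbit G \<phi> (\<phi> g x) = orbit G \<phi> x"
proof -
  have "\<phi> k (\<phi> g x) = \<phi> (k \<otimes> g) x" "\<phi> k x = \<phi> (k \<otimes> inv g) (\<phi> g x)" if "k \<in> carrier G" for k
    using assms that by (simp_all add: composition_rule act_closed act_inv)
  then show ?thesis
    unfolding orbit_def using assms by blast
qed

text \<open>Links the covers counted by \<open>IC\<close> to sets disjoint from their nontrivial
  translates: points of one orbit differ by some \<open>g\<close>, and by freeness only
  \<open>\<one>\<close> fixes a point.\<close>

lemma inj_on_orbit_iff:
  assumes "U \<subseteq> topspace X"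
  shows "inj_on (orbit G \<phi>) U \<longleftrightarrow> (\<forall>x\<in>U. \<forall>g\<in>carrier G. \<phi> g x \<in> U \<longrightarrow> g = \<one>)"
proof
  assume "inj_on (orbit G \<phi>) U"
  then show "\<forall>x\<in>U. \<forall>g\<in>carrier G. \<phi> g x \<in> U \<longrightarrow> g = \<one>"
    using assms free orbit_act by (metis inj_onD subsetD)
next
  assume R: "\<forall>x\<in>U. \<forall>g\<in>carrier G. \<phi> g x \<in> U \<longrightarrow> g = \<one>"
  show "inj_on (orbit G \<phi>) U"
  proof (rule inj_onI)
    fix x y assume "x \<in> U" "y \<in> U" "orbit G \<phi> x = orbit G \<phi> y"
    then show "x = y"
      using assms R by (metis act_one orbit_eqD subsetD)
  qed
qed

section \<open>Equivariant maps into configuration spaces\<close>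

lemma equivariant_map_conf_space:
  fixes f :: "'a \<Rightarrow> 'b"
  assumes h: "bij_betw h (carrier G) {1..order G}" and f: "continuous_map X Y f"
    and sep: "\<And>g x. g \<in> carrier G \<Longrightarrow> x \<in> topspace X \<Longrightarrow> f (\<phi> g x) = f x \<Longrightarrow> g = \<one>"
  obtains F where
    "equivariant_map G X \<phi> (conf_space Y (order G)) (conf_action G h Y) F"
proof
  define I where "I = {1..order G}"
  define e where "e = inv_into (carrier G) h"
  have e: "e j \<in> carrier G" if "j \<in> I" for j
    using h that unfolding e_def I_def by (metis bij_betw_imp_surj_on inv_into_into)
  have einj: "i = j" if "e i = e j" "i \<in> I" "j \<in> I" for i j
    using h that unfolding e_def I_def by (metis bij_betw_inv_into_right)
  have eh: "e (h g) = g" "h g \<in> I" if "g \<in> carrier G" for g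
    using bij_betw_inv_into_left[OF h that] bij_betwE[OF h] that by (auto simp: e_def I_def)
  \<comment> \<open>The inverse matches \<open>conf_action\<close>: coordinate \<open>j\<close> of
    \<open>F (\<phi> g x)\<close> is \<open>f\<close> at the translate of \<open>x\<close> by
    \<open>inv (e j) \<otimes> g\<close>, the inverse of \<open>inv g \<otimes> e j\<close>.\<close>
  define F where "F x = (\<lambda>j\<in>I. f (\<phi> (inv (e j)) x))" for x
  have "inj_on (F x) I" if x: "x \<in> topspace X" for x
  proof (rule inj_onI)
    fix i j assume ij: "i \<in> I" "j \<in> I" and "F x i = F x j"
    then have "f (\<phi> (inv (e j)) x) = f (\<phi> (inv (e i)) x)" by (simp add: F_def)
    \<comment> \<open>Exhibits the two points as translates of one another by
      \<open>inv (e j) \<otimes> e i\<close>, which \<open>sep\<close> then forces to be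
      \<open>\<one>\<close>.\<close>
    also have "inv (e j) = inv (e j) \<otimes> e i \<otimes> inv (e i)"
      using e ij by (simp add: m_assoc)
    finally have "f (\<phi> (inv (e j) \<otimes> e i) (\<phi> (inv (e i)) x)) = f (\<phi> (inv (e i)) x)"
      using e ij x by (simp add: composition_rule)
    then have "inv (e j) \<otimes> e i = \<one>"
      using e ij x by (intro sep) (auto intro: act_closed)
    then have "e i = e j"
      using e ij by (metis inv_closed inv_equality inv_inv)
    then show "i = j" using einj ij by blast
  qed
  moreover have "continuous_map X (product_topology (\<lambda>_. Y) I) F"
    unfolding continuous_map_componentwise
  proof (intro conjI ballI)
    show "F ` topspace X \<subseteq> extensional I" by (auto simp: F_def)
    fix j assume j: "j \<in> I"
    have "continuous_map X Y (\<lambda>x. f (\<phi> (inv (e j)) x))"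
      using continuous_map_compose[OF act_cont f] e[OF j] by (auto simp: o_def)
    then show "continuous_map X Y (\<lambda>x. F x j)" by (simp add: F_def j)
  qed
  ultimately have cont: "continuous_map X (conf_space Y (order G)) F"
    unfolding conf_space_def continuous_map_in_subtopology I_def[symmetric]
    by (auto simp: inj_on_def)
  have "F (\<phi> g x) = conf_action G h Y g (F x)" if g: "g \<in> carrier G" and x: "x \<in> topspace X" for g x
  proof -
    have "F x \<in> topspace (conf_space Y (order G))"
      using cont x by (auto simp: continuous_map_def)
    moreover have "f (\<phi> (inv (e j)) (\<phi> g x)) = F x (h (inv g \<otimes> e j))" if "j \<in> I" for j
      using g x e[OF that] by (simp add: F_def eh inv_mult_group composition_rule)
    moreover have "F (\<phi> g x) = (\<lambda>j\<in>I. f (\<phi> (inv (e j)) (\<phi> g x)))"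
      by (simp add: F_def)
    ultimately show ?thesis
      by (simp add: conf_action_def e_def[symmetric] I_def[symmetric] del: One_nat_def cong: restrict_cong)
  qed
  then show "equivariant_map G X \<phi> (conf_space Y (order G)) (conf_action G h Y) F"
    using cont by (simp add: equivariant_map_def)
qed

text \<open>Equivariance sends orbits into orbits; freeness of \<open>Y\<close> makes
  \<open>F\<close> injective on each orbit, since \<open>F x = \<psi> g (F x)\<close> forces
  \<open>g = \<one>\<close>.\<close>

lemma IC_orbit_le:
  assumes "free_action G Y \<psi>" and "equivariant_map G X \<phi> Y \<psi> F"
  shows "IC X (orbit G \<phi>) \<le> IC Y (orbit G \<psi>)"
proof -
  interpret Y: free_action G Y \<psi> by fact
  have F: "continuous_map X Y F" "\<And>g x. g \<in> carrier G \<Longrightarrow> x \<in> topspace X \<Longrightarrow> F (\<phi> g x) = \<psi> g (F x)"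
    using assms(2) by (auto simp: equivariant_map_def)
  have FY: "F x \<in> topspace Y" if "x \<in> topspace X" for x
    using F(1) that by (auto simp: continuous_map_def)
  show ?thesis
  proof (rule IC_le_IC[OF F(1)])
    fix x x' assume x: "x \<in> topspace X" "x' \<in> topspace X" "orbit G \<phi> x = orbit G \<phi> x'"
    then obtain g where g: "g \<in> carrier G" "x' = \<phi> g x" by (rule orbit_eqD)
    show "orbit G \<psi> (F x) = orbit G \<psi> (F x')"
      using g x F(2) FY Y.orbit_act by metis
    show "x = x'" if "F x = F x'"
      using that g x F(2) FY Y.free act_one by metis
  qed
qed

section \<open>From a finite cover to a map into Euclidean space\<close>

lemma slice_cover_Euclidean_map:
  assumes X: "metrizable_space X" and k: "1 \<le> k"
    and U: "\<And>i. i \<in> {1..k} \<Longrightarrow> openin X (U i)"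
    and inj: "\<And>i. i \<in> {1..k} \<Longrightarrow> inj_on (orbit G \<phi>) (U i)"
    and cov: "topspace X = (\<Union>i\<in>{1..k}. U i)"
  obtains f where "continuous_map X (Euclidean_space (k - 1)) f"
    "\<And>g x. g \<in> carrier G \<Longrightarrow> x \<in> topspace X \<Longrightarrow> f (\<phi> g x) = f x \<Longrightarrow> g = \<one>"
proof -
  have "\<forall>i\<in>{1..k}. \<exists>u :: 'a \<Rightarrow> real. continuous_map X euclideanreal u \<and> (\<forall>x. 0 \<le> u x) \<and>
      (\<forall>x\<in>topspace X. 0 < u x \<longleftrightarrow> x \<in> U i)"
    by (metis metrizable_space_cozero[OF X U])
  then obtain u :: "nat \<Rightarrow> 'a \<Rightarrow> real" where *: "\<forall>i\<in>{1..k}. continuous_map X euclideanreal (u i) \<and>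
      (\<forall>x. 0 \<le> u i x) \<and> (\<forall>x\<in>topspace X. 0 < u i x \<longleftrightarrow> x \<in> U i)"
    by (rule bchoice[THEN exE])
  have u: "continuous_map X euclideanreal (u i)" "0 \<le> u i x"
      "x \<in> topspace X \<Longrightarrow> 0 < u i x \<longleftrightarrow> x \<in> U i" if "i \<in> {1..k}" for i x
    using bspec[OF * that] by simp_all
  define S where "S x = (\<Sum>i\<in>{1..k}. u i x)" for x
  define p where "p i x = u i x / S x" for i x
  have S: "0 < S x" if x: "x \<in> topspace X" for x
  proof -
    obtain i where "i \<in> {1..k}" "x \<in> U i" using x[unfolded cov] by (rule UN_E)
    then show ?thesis
      unfolding S_def using u(2,3) x by (intro sum_pos2[of _ i]) auto
  qed
  \<comment> \<open>This recovers the dropped coordinate \<open>p k\<close> from the other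
    ones.\<close>
  have sum_p: "p k x = 1 - (\<Sum>i<k-1. p (Suc i) x)" if "x \<in> topspace X" for x
  proof -
    have "1 = (\<Sum>i\<in>{1..k}. p i x)"
      using S[OF that] by (simp add: p_def S_def flip: sum_divide_distrib)
    also have "\<dots> = (\<Sum>i<k. p (Suc i) x)"
      by (simp add: sum.atLeast1_atMost_eq)
    also have "\<dots> = (\<Sum>i<k-1. p (Suc i) x) + p k x"
      using k by (cases k) simp_all
    finally show ?thesis by simp
  qed
  \<comment> \<open>Covers are indexed from 1 and coordinates from 0, hence \<open>Suc i\<close>;
    the zeros from \<open>k - 1\<close> on are what membership in
    \<open>Euclidean_space (k - 1)\<close> requires.\<close>
  define f where "f x i = (if i < k - 1 then p (Suc i) x else 0)" for x i
  show thesis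
  proof (rule that)
    have "continuous_map X euclideanreal (p i)" if "i \<in> {1..k}" for i
      unfolding p_def S_def
    proof (intro continuous_map_real_divide continuous_map_sum u that)
      show "(\<Sum>i\<in>{1..k}. u i x) \<noteq> 0" if "x \<in> topspace X" for x
        using S[OF that] by (simp add: S_def)
    qed simp
    then show "continuous_map X (Euclidean_space (k - 1)) f"
      unfolding f_def continuous_map_componentwise_Euclidean_space by simp
  next
    fix g x assume g: "g \<in> carrier G" and x: "x \<in> topspace X" and eq: "f (\<phi> g x) = f x"
    have gx: "\<phi> g x \<in> topspace X" using g x by (rule act_closed)
    have lt: "p (Suc i) (\<phi> g x) = p (Suc i) x" if "i < k - 1" for i
      using fun_cong[OF eq, of i] that by (simp add: f_def)
    then have "p k (\<phi> g x) = p k x"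
      by (simp add: sum_p x gx)
    then have peq: "p i (\<phi> g x) = p i x" if "i \<in> {1..k}" for i
      using lt[of "i - 1"] that by (cases "i = k") auto
    \<comment> \<open>Some \<open>p i\<close> is positive at \<open>x\<close>, hence at
      \<open>\<phi> g x\<close>; both points lie in \<open>U i\<close>, which meets no nontrivial
      translate of itself.\<close>
    obtain i where i: "i \<in> {1..k}" "x \<in> U i" using x[unfolded cov] by (rule UN_E)
    then have "0 < p i x" using u(3) x S by (simp add: p_def)
    then have "0 < p i (\<phi> g x)" using peq i by simp
    then have "0 < u i (\<phi> g x)"
      using S[OF gx] by (simp add: p_def zero_less_divide_iff)
    then have "\<phi> g x \<in> U i" using u(3) i gx by simp
    then show "g = \<one>"
      using inj[OF i(1)] inj_on_orbit_iff[OF openin_subset[OF U[OF i(1)]]] i(2) g by blast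
  qed
qed

section \<open>Countable covers and the infinite index\<close>

text \<open>
  M. E. Stone's \<open>\<sigma>\<close>-discrete refinement of the cover by saturated balls \<open>V s\<close>, carried out in the
  invariant metric \<open>D\<close>: the pieces of level \<open>n\<close> that belong to different indices \<open>s\<close> have
  disjoint saturations, so cutting each of them down to a small ball about \<open>s\<close> leaves a set that
  meets no translate of itself.
\<close>

lemma countable_slice_cover:
  assumes X: "metrizable_space X" and fin: "finite (carrier G)"
  obtains U :: "nat \<Rightarrow> 'a set" where "\<And>n. openin X (U n)"
    "\<And>n x g. x \<in> U n \<Longrightarrow> g \<in> carrier G \<Longrightarrow> \<phi> g x \<in> U n \<Longrightarrow> g = \<one>"
    "\<And>x. x \<in> topspace X \<Longrightarrow> \<exists>n. \<exists>g\<in>carrier G. \<phi> g x \<in> U n"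
proof -
  obtain M d where "Metric_space M d" and Xeq: "X = Metric_space.mtopology M d"
    using X by (auto simp: metrizable_space_def)
  interpret Metric_space M d by fact
  have topX: "topspace X = M" by (simp add: Xeq)
  have inM: "\<phi> g x \<in> M" if "g \<in> carrier G" "x \<in> M" for g x
    using that act_closed by (simp add: topX)
  \<comment> \<open>Summing \<open>d\<close> over the group makes the metric invariant. It still
    induces the topology of \<open>X\<close>: its balls are open by continuity of the action, and
    \<open>d \<le> D\<close> gives the converse.\<close>
  define D where "D x y = (\<Sum>g\<in>carrier G. d (\<phi> g x) (\<phi> g y))" for x y
  have D_commute: "D x y = D y x" for x y by (simp add: D_def commute)
  have D_zero: "D x x = 0" if "x \<in> M" for x using that by (simp add: D_def inM)
  have D_tri: "D x z \<le> D x y + D y z" if "x \<in> M" "y \<in> M" "z \<in> M" for x y z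
    unfolding D_def sum.distrib[symmetric] using that by (intro sum_mono triangle inM)
  have d_le_D: "d x y \<le> D x y" if "x \<in> M" "y \<in> M" for x y
  proof -
    have "d (\<phi> \<one> x) (\<phi> \<one> y) \<le> D x y"
      unfolding D_def using fin by (intro member_le_sum) auto
    then show ?thesis using that by (simp add: act_one topX)
  qed
  have D_inv: "D (\<phi> k x) (\<phi> k y) = D x y" if "k \<in> carrier G" "x \<in> M" "y \<in> M" for k x y
  proof -
    have "bij_betw (\<lambda>g. g \<otimes> k) (carrier G) (carrier G)"
      by (rule bij_betw_byWitness[where f' = "\<lambda>g. g \<otimes> inv k"]) (use that in \<open>auto simp: m_assoc\<close>)
    then have "D x y = (\<Sum>g\<in>carrier G. d (\<phi> (g \<otimes> k) x) (\<phi> (g \<otimes> k) y))"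
      unfolding D_def by (rule sum.reindex_bij_betw[symmetric])
    also have "\<dots> = D (\<phi> k x) (\<phi> k y)"
      unfolding D_def using that by (intro sum.cong) (auto simp: composition_rule topX)
    finally show ?thesis by simp
  qed
  have D_ball: "openin X {y \<in> M. D x y < r}" if x: "x \<in> M" for x r
  proof -
    have "continuous_map X euclideanreal (\<lambda>y. d (\<phi> g x) (\<phi> g y))" if g: "g \<in> carrier G" for g
    proof -
      have "continuous_map X euclideanreal (d (\<phi> g x))"
        unfolding Xeq using g x
        by (intro continuous_map_real_Lipschitz) (metis triangle inM commute)
      then show ?thesis
        using continuous_map_compose[OF act_cont[OF g]] by (auto simp: o_def)
    qed
    then have "continuous_map X euclideanreal (D x)"
      unfolding D_def by (intro continuous_map_sum fin)
    then have "openin X {y \<in> topspace X. D x y \<in> {..<r}}"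
      by (intro openin_continuous_map_preimage[where Y = euclideanreal]) auto
    then show ?thesis by (simp add: topX)
  qed
  have D_nbhd: "\<exists>r>0. \<forall>y\<in>M. D x y < r \<longrightarrow> y \<in> W" if "openin X W" "x \<in> W" for x W
    using that d_le_D openin_subset[OF that(1)] unfolding Xeq openin_mtopology
    by (meson in_mball order_le_less_trans subsetD)
  have "\<exists>r>0. \<forall>g\<in>carrier G. D s (\<phi> g s) < 2 * r \<longrightarrow> g = \<one>" if s: "s \<in> M" for s
  proof -
    have pos: "0 < D s (\<phi> g s)" if "g \<in> carrier G - {\<one>}" for g
    proof -
      have "\<phi> g s \<noteq> s" using free[of g s] that s by (auto simp: topX)
      then have "0 < d s (\<phi> g s)" using s that inM by simp
      also have "\<dots> \<le> D s (\<phi> g s)" using s that inM by (intro d_le_D) auto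
      finally show ?thesis .
    qed
    \<comment> \<open>Twice \<open>r\<close> is at most the distance from \<open>s\<close> to any
      other point of its orbit. The inserted 1 keeps \<open>Min\<close> meaningful for a trivial
      group.\<close>
    define r where "r = Min (insert 1 ((\<lambda>g. D s (\<phi> g s)) ` (carrier G - {\<one>}))) / 2"
    have "0 < r" unfolding r_def using fin pos by (simp add: Min_gr_iff)
    moreover have "2 * r \<le> D s (\<phi> g s)" if "g \<in> carrier G - {\<one>}" for g
      unfolding r_def using fin that by (simp add: Min_le)
    ultimately show ?thesis by (metis DiffI empty_iff insert_iff not_less)
  qed
  then obtain r where r: "\<And>s. s \<in> M \<Longrightarrow> 0 < r s"
      "\<And>s g. s \<in> M \<Longrightarrow> g \<in> carrier G \<Longrightarrow> D s (\<phi> g s) < 2 * r s \<Longrightarrow> g = \<one>"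
    by metis
  define V where "V s = {y \<in> M. \<exists>g\<in>carrier G. D s (\<phi> g y) < r s}" for s
  have V_open: "openin X (V s)" if "s \<in> M" for s
  proof -
    have "V s = (\<Union>g\<in>carrier G. {y \<in> topspace X. \<phi> g y \<in> {z \<in> M. D s z < r s}})"
      by (auto simp: V_def topX inM)
    also have "openin X \<dots>"
      using openin_continuous_map_preimage[OF act_cont D_ball[OF that]]
      by (intro openin_Union) blast
    finally show ?thesis .
  qed
  have V_act: "\<phi> k y \<in> V s" if k: "k \<in> carrier G" and y: "y \<in> V s" for k y s
  proof -
    obtain g where g: "y \<in> M" "g \<in> carrier G" "D s (\<phi> g y) < r s"
      using y by (auto simp: V_def)
    then have "\<phi> (g \<otimes> inv k) (\<phi> k y) = \<phi> g y"
      using k by (simp add: composition_rule inM topX act_inv)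
    then show ?thesis
      using g k inM unfolding V_def by (auto intro!: bexI[of _ "g \<otimes> inv k"])
  qed
  have V_inv: "\<phi> k y \<in> V s \<longleftrightarrow> y \<in> V s" if "k \<in> carrier G" "y \<in> M" for k y s
    using V_act[of k y s] V_act[of "inv k" "\<phi> k y" s] that by (auto simp: act_inv topX)
  obtain R :: "'a rel" where R: "well_order_on M R"
    using well_order_on by blast
  have R_anti: "s = t" if "(s, t) \<in> R" "(t, s) \<in> R" for s t
    using R that by (metis antisymD well_order_on_def linear_order_on_def partial_order_on_def)
  \<comment> \<open>The well-order selects one \<open>V s\<close> among those containing
    \<open>y\<close>; comparing such first indices in both directions is what separates the pieces
    below.\<close>
  define least where "least y s \<longleftrightarrow> s \<in> M \<and> y \<in> V s \<and> (\<forall>t\<in>M. y \<in> V t \<longrightarrow> (s, t) \<in> R)" for y s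
  have least_ex: "\<exists>s. least y s" if y: "y \<in> M" for y
  proof -
    \<comment> \<open>Each point lies in its own ball, so the set to be minimised is
      nonempty.\<close>
    have "D y (\<phi> \<one> y) < r y" using y r(1) by (simp add: act_one topX D_zero)
    then have "y \<in> {s \<in> M. y \<in> V s}" using y unfolding V_def by blast
    moreover have "wf (R - Id)" using R by (simp add: well_order_on_def)
    ultimately obtain s where s: "s \<in> M" "y \<in> V s" "\<And>t. (t, s) \<in> R - Id \<Longrightarrow> \<not> (t \<in> M \<and> y \<in> V t)"
      by (elim wfE_min[where Q = "{s \<in> M. y \<in> V s}"]) auto
    have "(s, t) \<in> R" if "t \<in> M" "y \<in> V t" for t
      using s that R
      by (metis DiffI IdE pair_in_Id_conv well_order_on_def linear_order_on_def total_on_def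
          partial_order_on_def preorder_on_def refl_onD)
    then show ?thesis using s unfolding least_def by blast
  qed
  define \<epsilon> :: "nat \<Rightarrow> real" where "\<epsilon> n = inverse (Suc n)" for n
  have eps: "0 < \<epsilon> n" for n by (simp add: \<epsilon>_def)
  \<comment> \<open>Stone's pieces: points assigned to \<open>s\<close> that lie at depth
    \<open>\<epsilon> n\<close> inside \<open>V s\<close>.\<close>
  define inner where "inner n s = {y \<in> M. least y s \<and> (\<forall>z\<in>M. D y z < \<epsilon> n \<longrightarrow> z \<in> V s)}" for n s
  have inner_M: "s \<in> M" "y \<in> M" if "y \<in> inner n s" for n s y
    using that by (auto simp: inner_def least_def)
  \<comment> \<open>Depth puts \<open>y'\<close> in \<open>V s\<close>, so \<open>t\<close> precedes
    or equals \<open>s\<close>; by symmetry \<open>s\<close> precedes or equals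
    \<open>t\<close>.\<close>
  have inner_eq: "s = t" if "y \<in> inner n s" "y' \<in> inner n t" "k \<in> carrier G" "D (\<phi> k y) y' < \<epsilon> n"
    for n s t y y' k
  proof -
    have yM: "y \<in> M" "y' \<in> M" "\<phi> k y \<in> M" using that inner_M inM by blast+
    have "D y (\<phi> (inv k) y') = D (\<phi> k y) y'"
      using D_inv[of k y "\<phi> (inv k) y'"] that yM by (simp add: act_inv' inM topX)
    then have "\<phi> (inv k) y' \<in> V s"
      using that yM inM by (auto simp: inner_def)
    then have "y' \<in> V s" using V_inv[of "inv k"] that yM by simp
    then have "(t, s) \<in> R" using that by (simp add: inner_def least_def)
    moreover have "\<phi> k y \<in> V t"
      using that yM D_commute by (auto simp: inner_def)
    then have "y \<in> V t" using V_inv that yM by simp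
    then have "(s, t) \<in> R" using that by (simp add: inner_def least_def)
    ultimately show ?thesis using R_anti by blast
  qed
  \<comment> \<open>Two radii \<open>\<epsilon> n / 2\<close> add up to the separation in
    \<open>inner_eq\<close>, so neighbourhoods of pieces with different indices, and their
    translates, stay disjoint.\<close>
  define U where "U n = (\<Union>s\<in>M. \<Union>y\<in>inner n s. {x \<in> M. D s x < r s} \<inter> {x \<in> M. D y x < \<epsilon> n / 2})" for n
  show thesis
  proof (rule that[of U])
    show "openin X (U n)" for n
      unfolding U_def using inner_M D_ball
      by (intro openin_Union) (blast intro: openin_Int openin_Union)
  next
    fix n x g assume "x \<in> U n" and g: "g \<in> carrier G" and "\<phi> g x \<in> U n"
    then obtain s y t y' where x: "x \<in> M" "s \<in> M" "t \<in> M" "y \<in> inner n s" "y' \<in> inner n t"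
        "D s x < r s" "D y x < \<epsilon> n / 2" "D t (\<phi> g x) < r t" "D y' (\<phi> g x) < \<epsilon> n / 2"
      unfolding U_def by blast
    have yM: "y \<in> M" "y' \<in> M" using x inner_M by blast+
    have "D (\<phi> g y) y' \<le> D (\<phi> g y) (\<phi> g x) + D (\<phi> g x) y'"
      using g x yM by (intro D_tri inM)
    also have "\<dots> < \<epsilon> n"
      using x D_inv[OF g yM(1) x(1)] D_commute[of y' "\<phi> g x"] by simp
    finally have "s = t" using inner_eq x g by blast
    \<comment> \<open>Both \<open>x\<close> and \<open>\<phi> g x\<close> lie within
      \<open>r s\<close> of \<open>s\<close>, so \<open>g\<close> moves \<open>s\<close> by less
      than \<open>2 * r s\<close>.\<close>
    have "D s (\<phi> g s) \<le> D s (\<phi> g x) + D (\<phi> g x) (\<phi> g s)"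
      using g x by (intro D_tri inM)
    also have "\<dots> < 2 * r s"
      using x D_inv[OF g x(1,2)] D_commute[of x s] \<open>s = t\<close> by simp
    finally show "g = \<one>" using r(2) x g by blast
  next
    fix x assume "x \<in> topspace X"
    then have x: "x \<in> M" by (simp add: topX)
    obtain s where s: "least x s" using least_ex[OF x] by blast
    then have sM: "s \<in> M" and xV: "x \<in> V s" by (auto simp: least_def)
    \<comment> \<open>\<open>U n\<close> uses the ball about \<open>s\<close> itself, not its
      saturation, so \<open>x\<close> is first translated into that ball. This is why the sets
      \<open>U n\<close> are only claimed to cover \<open>X\<close> up to translation.\<close>
    obtain g where g: "g \<in> carrier G" "D s (\<phi> g x) < r s"
      using xV by (auto simp: V_def)
    have gx: "\<phi> g x \<in> M" using g x inM by blast
    have "\<phi> g x \<in> V s" using V_inv g x xV by simp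
    then obtain e where e: "0 < e" "\<And>z. z \<in> M \<Longrightarrow> D (\<phi> g x) z < e \<Longrightarrow> z \<in> V s"
      using D_nbhd[OF V_open[OF sM]] by blast
    obtain n where "\<epsilon> n < e"
      using reals_Archimedean[OF e(1)] by (auto simp: \<epsilon>_def)
    moreover have "least (\<phi> g x) s" using s V_inv[OF g(1) x] by (simp add: least_def)
    ultimately have "\<phi> g x \<in> inner n s"
      using e(2) gx by (auto simp: inner_def)
    moreover have "D (\<phi> g x) (\<phi> g x) < \<epsilon> n / 2" using D_zero[OF gx] eps by simp
    ultimately have "\<phi> g x \<in> U n"
      unfolding U_def using g gx sM by blast
    then show "\<exists>n. \<exists>g\<in>carrier G. \<phi> g x \<in> U n" using g by blast
  qed
qed

lemma Euclidean_colimit_map: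
  assumes X: "metrizable_space X" and fin: "finite (carrier G)"
  obtains f where "continuous_map X Euclidean_colimit f"
    "\<And>g x. g \<in> carrier G \<Longrightarrow> x \<in> topspace X \<Longrightarrow> f (\<phi> g x) = f x \<Longrightarrow> g = \<one>"
proof -
  obtain U :: "nat \<Rightarrow> 'a set" where U: "\<And>n. openin X (U n)"
      "\<And>n x g. x \<in> U n \<Longrightarrow> g \<in> carrier G \<Longrightarrow> \<phi> g x \<in> U n \<Longrightarrow> g = \<one>"
      "\<And>x. x \<in> topspace X \<Longrightarrow> \<exists>n. \<exists>g\<in>carrier G. \<phi> g x \<in> U n"
    using countable_slice_cover[OF assms] by blast
  define P where "P = (UNIV :: nat set) \<times> carrier G"
  \<comment> \<open>Preimages under the group elements turn the sets \<open>U n\<close> into a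
    genuine cover, still countable because the group is finite.\<close>
  define w where "w = (\<lambda>(n, k). {x \<in> topspace X. \<phi> k x \<in> U n})"
  have P: "countable P" "P \<noteq> {}"
    using fin by (auto simp: P_def intro: countable_finite)
  define W where "W i = w (from_nat_into P i)" for i
  have W_cases: "\<exists>n k. k \<in> carrier G \<and> W i = {x \<in> topspace X. \<phi> k x \<in> U n}" for i
  proof -
    obtain n k where "from_nat_into P i = (n, k)" "k \<in> carrier G"
      using from_nat_into[OF P(2), of i] by (auto simp: P_def)
    then show ?thesis unfolding W_def w_def by auto
  qed
  have W_slice: "g = \<one>" if "x \<in> W i" "\<phi> g x \<in> W i" and g: "g \<in> carrier G" for x i g
  proof -
    obtain n k where k: "k \<in> carrier G" and W: "W i = {x \<in> topspace X. \<phi> k x \<in> U n}"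
      using W_cases by blast
    then have x: "x \<in> topspace X" "\<phi> k x \<in> U n" "\<phi> k (\<phi> g x) \<in> U n" using that by auto
    \<comment> \<open>Conjugation by \<open>k\<close> carries the disjointness from translates over
      from \<open>U n\<close> to its preimage under \<open>\<phi> k\<close>.\<close>
    have "\<phi> (k \<otimes> g \<otimes> inv k) (\<phi> k x) = \<phi> k (\<phi> g x)"
      using x g k by (simp add: composition_rule act_closed act_inv)
    then have "k \<otimes> g \<otimes> inv k = \<one>"
      using x g k by (intro U(2)[OF x(2)]) auto
    then show ?thesis
      using g k by (metis inv_closed inv_equality inv_inv l_cancel_one m_closed)
  qed
  have W_open: "openin X (W i)" for i
    using W_cases[of i] openin_continuous_map_preimage[OF act_cont U(1)] by metis
  have W_cover: "topspace X \<subseteq> (\<Union>i. W i)"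
  proof
    fix x assume x: "x \<in> topspace X"
    then obtain n k where "k \<in> carrier G" "\<phi> k x \<in> U n" using U(3) by blast
    moreover from this obtain i where "from_nat_into P i = (n, k)"
      using from_nat_into_surj[OF P(1), of "(n, k)"] by (auto simp: P_def)
    ultimately have "x \<in> W i" using x by (simp add: W_def w_def)
    then show "x \<in> (\<Union>i. W i)" by blast
  qed
  obtain v :: "nat \<Rightarrow> 'a \<Rightarrow> real" where v: "\<And>n. continuous_map X euclideanreal (v n)"
    "\<And>n x. x \<in> topspace X \<Longrightarrow> v n x \<noteq> 0 \<Longrightarrow> x \<in> W n"
    "\<And>x. x \<in> topspace X \<Longrightarrow> \<exists>n. v n x \<noteq> 0"
    "\<And>x. x \<in> topspace X \<Longrightarrow> \<exists>N m. openin X N \<and> x \<in> N \<and> (\<forall>y\<in>N. \<forall>n\<ge>m. v n y = 0)"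
    by (rule metrizable_space_locally_finite_cozero[OF X W_open W_cover]) blast
  show thesis
  proof (rule that[of "\<lambda>x n. v n x"])
    show "continuous_map X Euclidean_colimit (\<lambda>x n. v n x)"
    proof (rule continuous_map_Euclidean_colimit[OF v(1)])
      fix x assume "x \<in> topspace X"
      then show "\<exists>N m. openin X N \<and> x \<in> N \<and>
          (\<lambda>x n. v n x) ` N \<subseteq> topspace (Euclidean_space m)"
        using v(4)[of x] by (simp add: topspace_Euclidean_space image_subset_iff)
    qed
  next
    fix g x assume g: "g \<in> carrier G" and x: "x \<in> topspace X"
      and eq: "(\<lambda>n. v n (\<phi> g x)) = (\<lambda>n. v n x)"
    \<comment> \<open>A coordinate nonzero at both \<open>x\<close> and \<open>\<phi> g x\<close>
      puts both points in one \<open>W n\<close>.\<close>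
    obtain n where n: "v n x \<noteq> 0" using v(3)[OF x] by blast
    then have "v n (\<phi> g x) \<noteq> 0" using fun_cong[OF eq, of n] by simp
    then show "g = \<one>"
      using W_slice[of x n g] v(2) n g x act_closed by blast
  qed
qed

section \<open>The two inequalities\<close>

lemma ind2_add_two_le_IC:
  assumes X: "metrizable_space X" "topspace X \<noteq> {}" and G: "order G > 1"
    and h: "bij_betw h (carrier G) {1..order G}"
  shows "ind2 G h X \<phi> + 2 \<le> IC X (orbit G \<phi>)"
proof (cases "IC X (orbit G \<phi>)")
  case (enat k)
  then obtain U where U: "1 \<le> k" "\<And>i. i \<in> {1..k} \<Longrightarrow> openin X (U i)"
      "\<And>i. i \<in> {1..k} \<Longrightarrow> inj_on (orbit G \<phi>) (U i)" "topspace X = (\<Union>i\<in>{1..k}. U i)"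
    by (rule IC_enatE) blast
  \<comment> \<open>A single set would be all of \<open>X\<close>, which is nonempty and invariant,
    so \<open>G\<close> would be trivial. Excluding this makes \<open>k - 2\<close> an honest
    difference.\<close>
  have "k \<noteq> 1"
  proof
    assume "k = 1"
    then have "inj_on (orbit G \<phi>) (topspace X)" using U(3,4) by simp
    moreover obtain x where "x \<in> topspace X" using X(2) by blast
    ultimately have "g = \<one>" if "g \<in> carrier G" for g
      using inj_on_orbit_iff[of "topspace X"] act_closed that by blast
    then have "carrier G = {\<one>}" by auto
    then show False using G by (simp add: order_def)
  qed
  then have "k = Suc (Suc (k - 2))" using U(1) by linarith
  then obtain m where m: "k = Suc (Suc m)" ..
  obtain f where f: "continuous_map X (Euclidean_space (k - 1)) f"
      "\<And>g x. g \<in> carrier G \<Longrightarrow> x \<in> topspace X \<Longrightarrow> f (\<phi> g x) = f x \<Longrightarrow> g = \<one>"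
    by (rule slice_cover_Euclidean_map[OF X(1) U]) blast+
  obtain F where "equivariant_map G X \<phi> (conf_space (Euclidean_space (k - 1)) (order G))
      (conf_action G h (Euclidean_space (k - 1))) F"
    by (rule equivariant_map_conf_space[OF h f])
  then have "equivariant_map G X \<phi> (conf_space (Euclidean_space (m + 1)) (order G))
      (conf_action G h (Euclidean_space (m + 1))) F"
    by (simp add: m)
  then have "ind2 G h X \<phi> \<le> enat m"
    unfolding ind2_def by (intro Inf_lower) blast
  then have "ind2 G h X \<phi> + 2 \<le> enat m + 2"
    by (rule add_right_mono)
  then show ?thesis
    by (simp add: enat m numeral_eq_enat)
qed simp

text \<open>For a finite index the map to pull back along is one that attains the infimum in
  \<open>ind2\<close>; for an infinite index it comes from
  \<open>Euclidean_colimit_map\<close>.\<close>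

lemma IC_le_IC_conf_space:
  assumes X: "metrizable_space X" and fin: "finite (carrier G)"
    and h: "bij_betw h (carrier G) {1..order G}"
  defines "Y \<equiv> Euclidean_enat (ind2 G h X \<phi> + 1)"
  shows "IC X (orbit G \<phi>) \<le> IC (conf_space Y (order G)) (orbit G (conf_action G h Y))"
proof -
  have "\<exists>F. equivariant_map G X \<phi> (conf_space Y (order G)) (conf_action G h Y) F"
  proof (cases "ind2 G h X \<phi>")
    case (enat m)
    define A where "A = {enat n | n. \<exists>f. equivariant_map G X \<phi> (conf_space (Euclidean_space (n + 1)) (order G))
          (conf_action G h (Euclidean_space (n + 1))) f}"
    have *: "Inf A = enat m" using enat by (simp add: ind2_def A_def)
    then have "A \<noteq> {}" by (auto simp: top_enat_def)
    then have "enat m \<in> A" using * by (metis all_not_in_conv wellorder_InfI)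
    then show ?thesis
      using enat by (auto simp: A_def Y_def Euclidean_enat_def one_enat_def)
  next
    case infinity
    then have "Y = Euclidean_colimit" by (simp add: Y_def Euclidean_enat_def)
    moreover obtain f where f: "continuous_map X Euclidean_colimit f"
        "\<And>g x. g \<in> carrier G \<Longrightarrow> x \<in> topspace X \<Longrightarrow> f (\<phi> g x) = f x \<Longrightarrow> g = \<one>"
      using Euclidean_colimit_map[OF X fin] by blast
    ultimately show ?thesis
      by (auto intro: equivariant_map_conf_space[OF h f])
  qed
  moreover have "free_action G (conf_space Y (order G)) (conf_action G h Y)"
    unfolding free_action_iff using h by (intro free_G_space_conf_space group_axioms)
  ultimately show ?thesis using IC_orbit_le by blast
qed

end

section \<open>Groups of order two\<close>

lemma IC_conf_space_Euclidean_space_le: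
  fixes G (structure)
  assumes "group G" and h: "bij_betw h (carrier G) {1..order G}" and two: "order G = 2"
  shows "IC (conf_space (Euclidean_space m) (order G)) (orbit G (conf_action G h (Euclidean_space m)))
    \<le> enat (m + 1)"
proof -
  define Z where "Z = conf_space (Euclidean_space m) (order G)"
  define \<psi> where "\<psi> = conf_action G h (Euclidean_space m)"
  interpret free_action G Z \<psi>
    unfolding free_action_iff Z_def \<psi>_def using assms(1,2) by (rule free_G_space_conf_space)
  have top: "topspace Z = {y \<in> {1..2} \<rightarrow>\<^sub>E topspace (Euclidean_space m). inj_on y {1..2}}"
    by (simp add: Z_def topspace_conf_space two)
  \<comment> \<open>\<open>z y\<close> is nonzero on configurations and the nontrivial element
    reverses its sign, so no linear form in \<open>z\<close> is positive on both points of an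
    orbit.\<close>
  define z where "z y i = y 1 i - y 2 i" for y :: "nat \<Rightarrow> nat \<Rightarrow> real" and i
  have z_cont: "continuous_map Z euclideanreal (\<lambda>y. z y i)" for i
  proof -
    have "continuous_map Z (Euclidean_space m) (\<lambda>y. y j)" if "j \<in> {1..2}" for j
      unfolding Z_def conf_space_def two using that
      by (intro continuous_map_from_subtopology continuous_map_product_projection)
    then have "continuous_map Z euclideanreal (\<lambda>y. y j i)" if "j \<in> {1..2}" for j
      using that unfolding Euclidean_space_def continuous_map_in_subtopology continuous_map_componentwise_UNIV
      by blast
    then show ?thesis unfolding z_def by (intro continuous_map_diff) auto
  qed
  have z_swap: "z (\<psi> g y) = (\<lambda>i. - z y i)"
    if g: "g \<in> carrier G" "g \<noteq> \<one>" and y: "y \<in> topspace Z" for g y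
  proof -
    define e where "e = inv_into (carrier G) h"
    have e: "e j \<in> carrier G" "h (e j) = j" if "j \<in> {1..2}" for j
      using h that unfolding e_def two
      by (metis bij_betw_imp_surj_on inv_into_into, meson bij_betw_inv_into_right)
    \<comment> \<open>Left translation has no fixed points: \<open>inv g \<otimes> e j\<close>
      differs from \<open>e j\<close>, and among the indices 1 and 2 the other one is
      \<open>3 - j\<close>.\<close>
    have swap: "h (inv g \<otimes> e j) = 3 - j" if j: "j \<in> {1..2}" for j
    proof -
      have "inv g \<otimes> e j \<noteq> e j"
        using g e(1)[OF j] by (metis inv_closed inv_inv inv_one r_cancel_one')
      then have "h (inv g \<otimes> e j) \<noteq> h (e j)"
        using h g e(1)[OF j] by (metis bij_betw_imp_inj_on inj_onD inv_closed m_closed)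
      moreover have "h (inv g \<otimes> e j) \<in> {1..2}"
        using bij_betwE[OF h] g e(1)[OF j] two by simp
      ultimately show ?thesis using e(2)[OF j] j by auto
    qed
    have "\<psi> g y j = y (3 - j)" if "j \<in> {1..2}" for j
      using y that swap[OF that] by (simp add: \<psi>_def conf_action_def Z_def two e_def)
    then show ?thesis by (simp add: z_def fun_eq_iff)
  qed
  \<comment> \<open>The open half spaces of the inward facet normals of a simplex cover the punctured \<open>m\<close>-space.\<close>
  define u where "u i y = (if i \<le> m then z y (i - 1) else - (\<Sum>j<m. z y j))" for i y
  define U where "U i = {y \<in> topspace Z. 0 < u i y}" for i
  have "IC Z (orbit G \<psi>) \<le> enat (m + 1)"
  proof (rule IC_le[where U = U])
    fix i assume "i \<in> {1..m + 1}"
    have "continuous_map Z euclideanreal (u i)"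
      unfolding u_def by (cases "i \<le> m") (auto intro!: continuous_map_minus continuous_map_sum z_cont)
    then have "openin Z {y \<in> topspace Z. u i y \<in> {0<..}}"
      by (rule openin_continuous_map_preimage) auto
    then show "openin Z (U i)" by (simp add: U_def)
    have "u i (\<psi> g y) = - u i y" if "g \<in> carrier G" "g \<noteq> \<one>" "y \<in> topspace Z" for g y
      by (simp add: u_def z_swap[OF that] sum_negf)
    then have "\<forall>y\<in>U i. \<forall>g\<in>carrier G. \<psi> g y \<in> U i \<longrightarrow> g = \<one>"
      unfolding U_def by fastforce
    then show "inj_on (orbit G \<psi>) (U i)"
      by (subst inj_on_orbit_iff) (auto simp: U_def)
  next
    \<comment> \<open>If no form is positive, the first \<open>m\<close> coordinates of
      \<open>z\<close> are nonpositive with nonnegative sum, hence zero; the later ones vanish in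
      \<open>Euclidean_space m\<close>, so the two points coincide.\<close>
    have "\<exists>i\<in>{1..m + 1}. 0 < u i y" if y: "y \<in> topspace Z" for y
    proof (rule ccontr)
      assume no: "\<not> (\<exists>i\<in>{1..m + 1}. 0 < u i y)"
      have le: "z y j \<le> 0" if "j < m" for j
        using no that by (auto simp: u_def dest!: bspec[of _ _ "Suc j"])
      have "u (m + 1) y \<le> 0" using no by force
      then have "0 \<le> (\<Sum>j<m. z y j)" by (simp add: u_def)
      then have "(\<Sum>j<m. - z y j) = 0"
        using le by (intro antisym sum_nonneg) (auto simp: sum_negf)
      then have "z y j = 0" if "j < m" for j
        using le that by (subst (asm) sum_nonneg_eq_0_iff) auto
      moreover have "y 1 \<in> topspace (Euclidean_space m)" "y 2 \<in> topspace (Euclidean_space m)"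
        using y by (auto simp: top)
      then have "z y j = 0" if "j \<ge> m" for j
        using that by (simp add: z_def topspace_Euclidean_space)
      ultimately have "z y j = 0" for j by (meson not_less)
      then have "y 1 = y 2" by (simp add: z_def fun_eq_iff)
      then show False using y by (auto simp: top dest: inj_onD)
    qed
    then show "topspace Z = (\<Union>i\<in>{1..m + 1}. U i)"
      unfolding U_def by blast
  qed simp
  then show ?thesis by (simp add: Z_def \<psi>_def)
qed

section \<open>Assembling the bounds\<close>

theorem theorem3p3:
  fixes G :: "('g, 'm) monoid_scheme" (structure)
    and h :: "'g \<Rightarrow> nat"
    and X :: "'a topology"
    and \<phi> :: "'g \<Rightarrow> 'a \<Rightarrow> 'a"
    and n :: enat
  assumes "group G" and "finite (carrier G)" and "order G > 1"
    and "bij_betw h (carrier G) {1..order G}"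
    and "metrizable_space X" and "topspace X \<noteq> {}"
    and "free_G_space G X \<phi>"
    and "n = ind2 G h X \<phi>"
  shows "n + 2 \<le> IC X (orbit G \<phi>) \<and>
         IC X (orbit G \<phi>) \<le>
           IC (conf_space (Euclidean_enat (n + 1)) (order G))
              (orbit G (conf_action G h (Euclidean_enat (n + 1)))) \<and>
         (G \<cong> integer_mod_group 2 \<longrightarrow>
           n + 2 = IC X (orbit G \<phi>) \<and>
           IC X (orbit G \<phi>) =
             IC (conf_space (Euclidean_enat (n + 1)) (order G))
                (orbit G (conf_action G h (Euclidean_enat (n + 1)))))"
proof -
  interpret free_action G X \<phi>
    using assms(7) by (simp add: free_action_iff)
  let ?C = "IC (conf_space (Euclidean_enat (n + 1)) (order G))
              (orbit G (conf_action G h (Euclidean_enat (n + 1))))"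
  have lower: "n + 2 \<le> IC X (orbit G \<phi>)"
    using ind2_add_two_le_IC assms by blast
  have upper: "IC X (orbit G \<phi>) \<le> ?C"
    using IC_le_IC_conf_space assms by blast
  \<comment> \<open>For \<open>n = k\<close> finite, the configurations lie in dimension
    \<open>k + 1\<close> and the half spaces number \<open>k + 2\<close>, so the chain of
    inequalities closes up. For \<open>n = \<infinity>\<close> the bound is trivial.\<close>
  have "?C \<le> n + 2" if "G \<cong> integer_mod_group 2"
  proof (cases n)
    case (enat k)
    have "order G = 2"
      using iso_same_card[OF that] by (simp add: order_def carrier_integer_mod_group)
    then show ?thesis
      using IC_conf_space_Euclidean_space_le[OF assms(1,4), of "k + 1"]
      by (simp add: enat Euclidean_enat_def one_enat_def numeral_eq_enat)
  qed simp
  with lower upper show ?thesis by (meson order_antisym order_trans)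
qed

end
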